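(* Let $\hat{B}^{ns}_k[\cdot]$ be the nonsymmetric nonlinear AMLI-cycle multigrid operator and let $\tilde{B}^{ns}_k[\cdot]$ be given by $n\ge1$ steps of the (full) nonlinear PCG method with $\hat{B}^{ns}_k[\cdot]$ as the preconditioner. Assume the approximation property: for all $2\le k\le J$ and all $v\in V_k$, $\|(I-P_{k-1})v\|_{A_k}^2\le \frac{c_1}{\rho(A_k)}\|A_kv\|^2$; and the smoothing property: for all $2\le k\le J$ and all $v\in V_k$, $\frac{c_2}{\rho(A_k)}(v,v)\le(\tilde R_kv,v)$; where $c_1,c_2>0$ are constants independent of $k$. Then, with $\delta=\frac{c_1}{c_1+c_2}<1$ (independent of $k$), for every $k\in\{1,\dots,J\}$ and every $v\in V_k$, $$\| v - \hat{B}^{ns}_k[A_kv] \|_{A_k}^2 \leq \delta \| v \|_{A_k}^2,\qquad \| v - \tilde{B}^{ns}_k[A_kv] \|_{A_k}^2 \leq \delta^n \| v \|_{A_k}^2.$$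
   Context: Setting. $V$ is a finite-dimensional real vector space with inner product $(\cdot,\cdot)$ and norm $\|\cdot\|$; $A:V\to V$ is symmetric positive definite (SPD) with respect to $(\cdot,\cdot)$; $(u,v)_A=(Au,v)$. $V_1\subset V_2\subset\cdots\subset V_J=V$ are nested subspaces. $Q_k,P_k:V\to V_k$ are the orthogonal projections with respect to $(\cdot,\cdot)$ and $(\cdot,\cdot)_A$. $A_k:V_k\to V_k$ is defined by $(A_ku_k,v_k)=(u_k,v_k)_A$ for $u_k,v_k\in V_k$; it is SPD, $(u,v)_{A_k}=(A_ku,v)$, with norm $\|\cdot\|_{A_k}$ (also used for the induced operator norm); $\rho(A_k)$ is the spectral radius. $R_k:V_k\to V_k$ ($2\le k\le J$) are given linear smoothers, always assumed convergent: $\|I-R_kA_k\|_{A_k}<1$; $R_k^t$ is the adjoint of $R_k$ with respect to $(\cdot,\cdot)$, and $\tilde R_k$ is defined by $I-\tilde R_kA_k=(I-R_kA_k)(I-R_k^tA_k)$. Nonlinear PCG ($n$ steps, full version, $n\ge1$ fixed) on $V_k$ with a given, possibly nonlinear, preconditioner $\hat B_k[\cdot]:V_k\to V_k$: for $f\in V_k$ put $u_0=0$, $r_0=f$, $p_0=\hat B_k[r_0]$; for $i=1,\dots,n-1$, $p_i=\hat B_k[r_i]+\sum_{j=0}^{i-1}\beta_{i,j}p_j$ with $\beta_{i,j}=-(\hat B_k[r_i],p_j)_{A_k}/(p_j,p_j)_{A_k}$; for $i=0,\dots,n-1$, $\alpha_i=(r_i,p_i)/(p_i,p_i)_{A_k}$,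 $u_{i+1}=u_i+\alpha_ip_i$, $r_{i+1}=r_i-\alpha_iA_kp_i$. The output is $\tilde B_k[f]:=u_n$. Convention: a coefficient $\alpha_i$ or $\beta_{i,j}$ whose denominator vanishes is taken to be $0$. Nonsymmetric nonlinear AMLI-cycle: $\hat B_1^{ns}[f]=A_1^{-1}f$ and, for $k\ge2$, $f\in V_k$, with $u_1=R_kf$: $\hat B_k^{ns}[f]=u_1+\tilde B_{k-1}^{ns}[Q_{k-1}(f-A_ku_1)]$, where on each level $\tilde B_{j}^{ns}[\cdot]$ is the operator produced by $n$ steps of nonlinear PCG on $V_{j}$ with preconditioner $\hat B_{j}^{ns}[\cdot]$. *)

theory Defs
  imports "HOL-Analysis.Analysis"
begin

section \<open>Operators on an inner product space and on its subspaces\<close>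

text \<open>Operators on a subspace \<open>W\<close> are total functions whose values outside \<open>W\<close> are irrelevant.\<close>

definition spd :: "('a::real_inner \<Rightarrow> 'a) \<Rightarrow> bool" where
  "spd A \<longleftrightarrow> linear A \<and> (\<forall>u v. A u \<bullet> v = u \<bullet> A v) \<and> (\<forall>u. u \<noteq> 0 \<longrightarrow> 0 < A u \<bullet> u)"

definition linear_endo_on :: "'a::real_vector set \<Rightarrow> ('a \<Rightarrow> 'a) \<Rightarrow> bool" where
  "linear_endo_on W T \<longleftrightarrow>
     T ` W \<subseteq> W \<and>
     (\<forall>u\<in>W. \<forall>v\<in>W. T (u + v) = T u + T v) \<and>
     (\<forall>c. \<forall>u\<in>W. T (c *\<^sub>R u) = c *\<^sub>R T u)"

definition orth_proj :: "('a::real_vector \<Rightarrow> 'a \<Rightarrow> real) \<Rightarrow> 'a set \<Rightarrow> 'a \<Rightarrow> 'a" where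
  "orth_proj ip W u = (THE w. w \<in> W \<and> (\<forall>v\<in>W. ip (u - w) v = 0))"

definition adjoint_on :: "'a::real_inner set \<Rightarrow> ('a \<Rightarrow> 'a) \<Rightarrow> 'a \<Rightarrow> 'a" where
  "adjoint_on W T u = (THE w. w \<in> W \<and> (\<forall>v\<in>W. w \<bullet> v = u \<bullet> T v))"

definition energy_norm :: "('a::real_inner \<Rightarrow> 'a) \<Rightarrow> 'a \<Rightarrow> real" where
  "energy_norm A v = sqrt (A v \<bullet> v)"

text \<open>The operator norm on \<open>W\<close> induced by the energy norm of \<open>A\<close>, in the style of \<^const>\<open>onorm\<close>
  (the vector 0 contributes the value \<open>0 / 0 = 0\<close>).\<close>

definition energy_onorm :: "'a::real_inner set \<Rightarrow> ('a \<Rightarrow> 'a) \<Rightarrow> ('a \<Rightarrow> 'a) \<Rightarrow> real" where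
  "energy_onorm W A T = (SUP v\<in>W. energy_norm A (T v) / energy_norm A v)"

text \<open>The complex number \<open>z\<close> is an eigenvalue of (the complexification of) \<open>T\<close> on \<open>W\<close>, with
  eigenvector \<open>x + i y\<close>.  The element 0 in the spectral radius only matters for \<open>W = {0}\<close>.\<close>

definition eigenvalue_on :: "'a::real_vector set \<Rightarrow> ('a \<Rightarrow> 'a) \<Rightarrow> complex \<Rightarrow> bool" where
  "eigenvalue_on W T z \<longleftrightarrow>
     (\<exists>x\<in>W. \<exists>y\<in>W. (x \<noteq> 0 \<or> y \<noteq> 0) \<and>
        T x = Re z *\<^sub>R x - Im z *\<^sub>R y \<and> T y = Im z *\<^sub>R x + Re z *\<^sub>R y)"

definition spectral_radius_on :: "'a::real_vector set \<Rightarrow> ('a \<Rightarrow> 'a) \<Rightarrow> real" where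
  "spectral_radius_on W T = Sup (insert 0 (cmod ` {z. eigenvalue_on W T z}))"

section \<open>The level operators\<close>

definition level_op :: "('a::real_inner \<Rightarrow> 'a) \<Rightarrow> 'a set \<Rightarrow> 'a \<Rightarrow> 'a" where
  "level_op A W u = (THE w. w \<in> W \<and> (\<forall>v\<in>W. w \<bullet> v = A u \<bullet> v))"

text \<open>The operator \<open>R'\<close> on \<open>W\<close> with \<open>I - R' A = (I - R A) (I - R\<^sup>t A)\<close>, where \<open>A\<close> is the level
  operator; it is evaluated at \<open>w = A v\<close>.\<close>

definition symm_smoother ::
    "'a::real_inner set \<Rightarrow> ('a \<Rightarrow> 'a) \<Rightarrow> ('a \<Rightarrow> 'a) \<Rightarrow> 'a \<Rightarrow> 'a" where
  "symm_smoother W A R w =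
     (let v = inv_into W A w;
          y = v - adjoint_on W R (A v)
      in v - (y - R (A y)))"

section \<open>Nonlinear preconditioned conjugate gradients\<close>

text \<open>Residuals, search directions and iterates of the full version for the operator \<open>A\<close>, the
  preconditioner \<open>B\<close> and the right-hand side \<open>f\<close>.  A coefficient with vanishing denominator
  is 0, by the library convention \<open>x / 0 = 0\<close>.\<close>

function (sequential)
      pcg_res :: "('a::real_inner \<Rightarrow> 'a) \<Rightarrow> ('a \<Rightarrow> 'a) \<Rightarrow> 'a \<Rightarrow> nat \<Rightarrow> 'a"
  and pcg_dir :: "('a::real_inner \<Rightarrow> 'a) \<Rightarrow> ('a \<Rightarrow> 'a) \<Rightarrow> 'a \<Rightarrow> nat \<Rightarrow> 'a"
where
  "pcg_res A B f 0 = f"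
| "pcg_res A B f (Suc i) =
     (let r = pcg_res A B f i; p = pcg_dir A B f i
      in r - ((r \<bullet> p) / (A p \<bullet> p)) *\<^sub>R A p)"
| "pcg_dir A B f i =
     B (pcg_res A B f i) +
     (\<Sum>j<i. (- (A (B (pcg_res A B f i)) \<bullet> pcg_dir A B f j)
               / (A (pcg_dir A B f j) \<bullet> pcg_dir A B f j)) *\<^sub>R pcg_dir A B f j)"
  by pat_completeness auto

termination
  by (relation "Wellfounded.measure (\<lambda>x. case x of Inl (_, _, _, i) \<Rightarrow> 2 * i | Inr (_, _, _, i) \<Rightarrow> 2 * i + 1)")
    auto

primrec pcg_iter :: "('a::real_inner \<Rightarrow> 'a) \<Rightarrow> ('a \<Rightarrow> 'a) \<Rightarrow> 'a \<Rightarrow> nat \<Rightarrow> 'a" where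
  "pcg_iter A B f 0 = 0"
| "pcg_iter A B f (Suc i) =
     pcg_iter A B f i +
     ((pcg_res A B f i \<bullet> pcg_dir A B f i) / (A (pcg_dir A B f i) \<bullet> pcg_dir A B f i))
       *\<^sub>R pcg_dir A B f i"

definition npcg :: "nat \<Rightarrow> ('a::real_inner \<Rightarrow> 'a) \<Rightarrow> ('a \<Rightarrow> 'a) \<Rightarrow> 'a \<Rightarrow> 'a" where
  "npcg n A B f = pcg_iter A B f n"

section \<open>The nonsymmetric nonlinear AMLI-cycle\<close>

text \<open>Levels are numbered from 1; the value at level 0 is a dummy.\<close>

fun amli_ns :: "nat \<Rightarrow> ('a::real_inner \<Rightarrow> 'a) \<Rightarrow> (nat \<Rightarrow> 'a set) \<Rightarrow> (nat \<Rightarrow> 'a \<Rightarrow> 'a)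
    \<Rightarrow> nat \<Rightarrow> 'a \<Rightarrow> 'a" where
  "amli_ns n A V R 0 = (\<lambda>f. 0)"
| "amli_ns n A V R (Suc 0) = (\<lambda>f. inv_into (V 1) (level_op A (V 1)) f)"
| "amli_ns n A V R (Suc (Suc k)) =
     (\<lambda>f. let u\<^sub>1 = R (Suc (Suc k)) f
          in u\<^sub>1 + npcg n (level_op A (V (Suc k))) (amli_ns n A V R (Suc k))
                 (orth_proj (\<bullet>) (V (Suc k)) (f - level_op A (V (Suc (Suc k))) u\<^sub>1)))"

definition amli_ns_pcg :: "nat \<Rightarrow> ('a::real_inner \<Rightarrow> 'a) \<Rightarrow> (nat \<Rightarrow> 'a set) \<Rightarrow> (nat \<Rightarrow> 'a \<Rightarrow> 'a)
    \<Rightarrow> nat \<Rightarrow> 'a \<Rightarrow> 'a" where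
  "amli_ns_pcg n A V R k = npcg n (level_op A (V k)) (amli_ns n A V R k)"

end

theory Submission
  imports Defs
begin

text \<open>Write \<open>|.|\<close> for the energy norm, \<open>S = I - R A\<close> for the error propagator of the smoother on level
  \<open>k\<close>, \<open>S'\<close> for its energy adjoint, \<open>P\<close> for the energy projection onto the coarser level and
  \<open>c = c\<^sub>2 / c\<^sub>1\<close>.  Approximation at \<open>v\<close> and smoothing at \<open>A v\<close> combine, whatever the value of the
  spectral radius, to \<open>|S' z|\<^sup>2 + c |z - P z|\<^sup>2 \<le> |z|\<^sup>2\<close>.  A duality argument turns this into
  \<open>|S v|\<^sup>2 + c |S v - P S v|\<^sup>2 \<le> |v|\<^sup>2\<close>.  The multigrid error is the energy-orthogonal sum of
  \<open>S v - P S v\<close> and the coarse-level error started from \<open>P S v\<close>, so the bound for a level follows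
  from the one for the coarser level.  Finally, one step of full nonlinear PCG minimises the energy
  error over the span of the directions, which contains the preconditioned residual, so each step
  gains at least the factor \<open>\<delta>\<close> of the preconditioner.\<close>

section \<open>Representing vectors in subspaces\<close>

text \<open>An orthonormal basis of \<open>W\<close> gives the representing vector explicitly. This
  makes the definite descriptions in \<open>adjoint_on\<close> and \<open>level_op\<close>
  meaningful. Linearity of \<open>g\<close> is asked on \<open>W\<close> only, since a smoother is
  linear only there.\<close>

lemma subspace_riesz:
  fixes W :: "'a::euclidean_space set" and g :: "'a \<Rightarrow> real"
  assumes W: "subspace W"
    and add: "\<And>u v. u \<in> W \<Longrightarrow> v \<in> W \<Longrightarrow> g (u + v) = g u + g v"
    and scale: "\<And>c u. u \<in> W \<Longrightarrow> g (c *\<^sub>R u) = c * g u"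
  shows "\<exists>!w. w \<in> W \<and> (\<forall>v\<in>W. w \<bullet> v = g v)"
proof -
  obtain B where B: "B \<subseteq> W" "pairwise orthogonal B" "\<And>x. x \<in> B \<Longrightarrow> norm x = 1"
      "independent B" "span B = W"
    using orthonormal_basis_subspace[OF W] by metis
  have fin: "finite B"
    using B(4) independent_imp_finite by blast
  define w where "w = (\<Sum>b\<in>B. g b *\<^sub>R b)"
  have wW: "w \<in> W"
    unfolding w_def using B(1) W by (meson subsetD subspace_scale subspace_sum)
  have wb: "w \<bullet> b = g b" if "b \<in> B" for b
  proof -
    have "w \<bullet> b = (\<Sum>x\<in>B. if x = b then g b else 0)"
      unfolding w_def inner_sum_left
      using that B(2,3) by (intro sum.cong) (auto simp: pairwise_def orthogonal_def norm_eq_1)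
    then show ?thesis
      using that fin by simp
  qed
  have g0: "g 0 = 0"
    using scale[of 0 0] subspace_0[OF W] by simp
  have "v \<in> W \<and> w \<bullet> v = g v" if "v \<in> span B" for v
    using that
  proof (induction rule: span_induct_alt)
    case base
    show ?case using g0 W by (simp add: subspace_0)
  next
    case (step c x y)
    then have "x \<in> W" "y \<in> W"
      using B(1) by auto
    with step show ?case
      using add[of "c *\<^sub>R x" y] scale[of x c] wb[of x] W
      by (simp add: inner_add_right subspace_add subspace_scale)
  qed
  then have wv: "w \<in> W \<and> (\<forall>v\<in>W. w \<bullet> v = g v)"
    using B(5) wW by blast
  moreover have "w' = w" if "w' \<in> W \<and> (\<forall>v\<in>W. w' \<bullet> v = g v)" for w'
  proof -
    have "w' - w \<in> W"
      using that wW W by (simp add: subspace_diff)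
    then have "(w' - w) \<bullet> (w' - w) = 0"
      using that wv by (simp add: inner_diff_left)
    then show ?thesis by simp
  qed
  ultimately show ?thesis by blast
qed

lemma subspace_inner_eqI:
  fixes W :: "'a::real_inner set"
  assumes "subspace W" "x \<in> W" "y \<in> W" "\<And>v. v \<in> W \<Longrightarrow> x \<bullet> v = y \<bullet> v"
  shows "x = y"
proof -
  have "(x - y) \<bullet> (x - y) = 0"
    using assms by (simp add: inner_diff_left subspace_diff)
  then show ?thesis by simp
qed

lemma adjoint_on:
  fixes W :: "'a::euclidean_space set"
  assumes "subspace W" "linear_endo_on W T"
  shows adjoint_on_mem: "adjoint_on W T u \<in> W"
    and adjoint_on_inner: "v \<in> W \<Longrightarrow> adjoint_on W T u \<bullet> v = u \<bullet> T v"
proof -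
  have "\<exists>!w. w \<in> W \<and> (\<forall>v\<in>W. w \<bullet> v = u \<bullet> T v)"
    using assms by (intro subspace_riesz) (auto simp: linear_endo_on_def inner_add_right)
  from theI'[OF this] show "adjoint_on W T u \<in> W" "v \<in> W \<Longrightarrow> adjoint_on W T u \<bullet> v = u \<bullet> T v"
    unfolding adjoint_on_def by auto
qed

lemma level_op:
  fixes W :: "'a::euclidean_space set"
  assumes "subspace W"
  shows level_op_mem: "level_op A W u \<in> W"
    and level_op_inner: "v \<in> W \<Longrightarrow> level_op A W u \<bullet> v = A u \<bullet> v"
proof -
  have "\<exists>!w. w \<in> W \<and> (\<forall>v\<in>W. w \<bullet> v = A u \<bullet> v)"
    using assms by (intro subspace_riesz) (auto simp: inner_add_right)
  from theI'[OF this] show "level_op A W u \<in> W" "v \<in> W \<Longrightarrow> level_op A W u \<bullet> v = A u \<bullet> v"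
    unfolding level_op_def by auto
qed

lemma linear_level_op:
  fixes W :: "'a::euclidean_space set"
  assumes "subspace W" "linear A"
  shows "linear (level_op A W)"
proof (rule linearI)
  show "level_op A W (x + y) = level_op A W x + level_op A W y" for x y
    using assms by (intro subspace_inner_eqI[of W])
      (auto simp: level_op subspace_add inner_add_left linear_add)
  show "level_op A W (c *\<^sub>R x) = c *\<^sub>R level_op A W x" for c x
    using assms by (intro subspace_inner_eqI[of W])
      (auto simp: level_op subspace_scale linear_scale)
qed

section \<open>Operators that are positive definite on a subspace\<close>

text \<open>The model is \<open>level_op A W\<close>, which projects \<open>A u\<close> to
  \<open>W\<close>: it is linear on the whole space, while symmetry and definiteness hold in general
  only on \<open>W\<close>.\<close>

locale spd_on =
  fixes W :: "'a::euclidean_space set" and L :: "'a \<Rightarrow> 'a"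
  assumes sub: "subspace W"
    and lin: "linear L"
    and maps: "\<And>u. u \<in> W \<Longrightarrow> L u \<in> W"
    and sym: "\<And>u v. u \<in> W \<Longrightarrow> v \<in> W \<Longrightarrow> L u \<bullet> v = L v \<bullet> u"
    and pos: "\<And>u. u \<in> W \<Longrightarrow> u \<noteq> 0 \<Longrightarrow> 0 < L u \<bullet> u"
begin

lemma nonneg: "u \<in> W \<Longrightarrow> 0 \<le> L u \<bullet> u"
  using pos[of u] linear_0[OF lin] by (cases "u = 0") auto

lemma energy_zero_iff: "u \<in> W \<Longrightarrow> L u \<bullet> u = 0 \<longleftrightarrow> u = 0"
  using pos[of u] linear_0[OF lin] by (cases "u = 0") auto

lemma energy_norm_sq: "u \<in> W \<Longrightarrow> (energy_norm L u)\<^sup>2 = L u \<bullet> u"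
  unfolding energy_norm_def using nonneg by simp

lemma inj: "inj_on L W"
proof (rule inj_onI)
  fix x y assume "x \<in> W" "y \<in> W" "L x = L y"
  then have "L (x - y) \<bullet> (x - y) = 0" "x - y \<in> W"
    using lin sub by (auto simp: linear_diff subspace_diff)
  then show "x = y"
    using energy_zero_iff by force
qed

text \<open>An injective linear map of \<open>W\<close> into itself is onto by dimension. Hence
  every right-hand side in \<open>W\<close> has the form \<open>L v\<close>, and PCG can be studied
  through its error.\<close>

lemma image_eq: "L ` W = W"
proof (rule subspace_dim_equal)
  show "subspace (L ` W)" by (rule linear_subspace_image[OF lin sub])
  show "dim W \<le> dim (L ` W)"
    using dim_image_eq[OF lin] inj sub by (metis order_refl span_eq_iff)
qed (use maps sub in auto)

lemma inv_into_mem: "f \<in> W \<Longrightarrow> inv_into W L f \<in> W"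
  using image_eq by (simp add: inv_into_into)

lemma energy_add_orth:
  assumes "x \<in> W" "q \<in> W" "L x \<bullet> q = 0"
  shows "L (x + q) \<bullet> (x + q) = L x \<bullet> x + L q \<bullet> q"
  using assms sym[of q x] lin by (simp add: linear_add inner_add_left inner_add_right)

text \<open>In operator notation: \<open>S S' \<le> I - c N\<close> implies \<open>S' (I + c N) S \<le> I\<close> for the projection
  \<open>N = I - P\<close>.  Here \<open>x = P S v\<close> and \<open>q = N S v\<close>, and the hypothesis is tested with
  \<open>z = (I + c N) S v\<close>.\<close>

lemma smoother_duality:
  assumes mem: "v \<in> W" "x \<in> W" "q \<in> W" "z' \<in> W" and orth: "L x \<bullet> q = 0" and c: "0 \<le> c"
    and adj: "L (x + (1 + c) *\<^sub>R q) \<bullet> (x + q) = L z' \<bullet> v"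
    and bound: "L z' \<bullet> z' + c * (L ((1 + c) *\<^sub>R q) \<bullet> ((1 + c) *\<^sub>R q))
      \<le> L (x + (1 + c) *\<^sub>R q) \<bullet> (x + (1 + c) *\<^sub>R q)"
  shows "L x \<bullet> x + (1 + c) * (L q \<bullet> q) \<le> L v \<bullet> v"
proof -
  let ?q = "L q \<bullet> q"
  \<comment> \<open>Expanding this square takes the place of the Cauchy-Schwarz inequality.\<close>
  have "0 \<le> L (z' - v) \<bullet> (z' - v)"
    using mem sub by (simp add: nonneg subspace_diff)
  then have amgm: "2 * (L z' \<bullet> v) \<le> L z' \<bullet> z' + L v \<bullet> v"
    using mem sym[of v z'] lin by (simp add: linear_diff inner_diff_left inner_diff_right)
  have "L z' \<bullet> v = L x \<bullet> x + (1 + c) * ?q"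
    unfolding adj[symmetric] using orth mem sym[of q x] lin
    by (simp add: linear_add linear_scale inner_add_left inner_add_right)
  moreover have "L z' \<bullet> z' + c * ((1 + c)\<^sup>2 * ?q) \<le> L x \<bullet> x + (1 + c)\<^sup>2 * ?q"
    using bound orth mem sub lin energy_add_orth[of x "(1 + c) *\<^sub>R q"]
    by (simp add: subspace_scale linear_scale power2_eq_square mult.assoc)
  \<comment> \<open>The two sides differ by \<open>c\<^sup>2 * (1 + c) * ?q\<close>, which is
    nonnegative.\<close>
  moreover have "(1 + c)\<^sup>2 * ?q - c * ((1 + c)\<^sup>2 * ?q) \<le> (1 + c) * ?q"
  proof -
    have "(1 + c)\<^sup>2 - c * (1 + c)\<^sup>2 = (1 + c) - c\<^sup>2 * (1 + c)"
      by (simp add: power2_eq_square algebra_simps)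
    also have "\<dots> \<le> 1 + c"
      using c by simp
    finally have "((1 + c)\<^sup>2 - c * (1 + c)\<^sup>2) * ?q \<le> (1 + c) * ?q"
      using nonneg[OF mem(3)] by (rule mult_right_mono)
    then show ?thesis
      by (simp add: algebra_simps)
  qed
  ultimately show ?thesis
    using amgm by linarith
qed

section \<open>Full nonlinear PCG\<close>

declare pcg_res.simps [simp del] pcg_dir.simps [simp del]

context
  fixes B :: "'a \<Rightarrow> 'a" and v :: 'a
  assumes v: "v \<in> W" and B: "\<And>f. f \<in> W \<Longrightarrow> B f \<in> W"
begin

text \<open>With right-hand side \<open>L v\<close> the exact solution is \<open>v\<close>, so
  \<open>err i\<close> is the error of the iterate \<open>i\<close>.\<close>

abbreviation "res \<equiv> pcg_res L B (L v)"
abbreviation "dir \<equiv> pcg_dir L B (L v)"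
abbreviation "err i \<equiv> v - pcg_iter L B (L v) i"

lemma res_Suc: "res (Suc i) = res i - ((res i \<bullet> dir i) / (L (dir i) \<bullet> dir i)) *\<^sub>R L (dir i)"
  by (simp add: pcg_res.simps Let_def)

lemma dir_eq: "dir i = B (res i) + (\<Sum>j<i. (- (L (B (res i)) \<bullet> dir j) / (L (dir j) \<bullet> dir j)) *\<^sub>R dir j)"
  by (rule pcg_dir.simps)

lemma err_Suc: "err (Suc i) = err i - ((res i \<bullet> dir i) / (L (dir i) \<bullet> dir i)) *\<^sub>R dir i"
  by simp

lemma dir_mem_if: "res i \<in> W \<Longrightarrow> (\<And>j. j < i \<Longrightarrow> dir j \<in> W) \<Longrightarrow> dir i \<in> W"
  by (subst dir_eq) (intro subspace_add[OF sub] subspace_sum[OF sub] subspace_scale[OF sub] B; simp)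

text \<open>The three claims need each other: a direction is built from a residual in
  \<open>W\<close>, the residual is the image of the error, and the next error uses the
  direction.\<close>

lemma pcg_invariant: "err i \<in> W \<and> res i = L (err i) \<and> (\<forall>j<i. dir j \<in> W)"
proof (induction i)
  case 0
  show ?case using v by (simp add: pcg_res.simps)
next
  case (Suc i)
  then have "dir i \<in> W"
    by - (rule dir_mem_if, auto simp: maps)
  with Suc show ?case
    unfolding err_Suc res_Suc
    using sub lin by (auto simp: less_Suc_eq subspace_diff subspace_scale linear_diff linear_scale)
qed

lemma err_mem: "err i \<in> W" and res_eq: "res i = L (err i)" and dir_mem: "dir i \<in> W"
  \<comment> \<open>The invariant covers directions of smaller index only, so \<open>dir i\<close>
    comes from its instance at \<open>Suc i\<close>.\<close>
  using pcg_invariant[of i] pcg_invariant[of "Suc i"] by blast+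

lemma res_mem: "res i \<in> W"
  using maps[OF err_mem] res_eq by simp

text \<open>If the denominator vanishes then \<open>dir j = 0\<close>, so the junk value of the quotient is harmless.\<close>

lemma divide_dir: "(t \<bullet> dir j) / (L (dir j) \<bullet> dir j) * (L (dir j) \<bullet> dir j) = t \<bullet> dir j"
  using energy_zero_iff[OF dir_mem, of j] by (cases "dir j = 0") auto

text \<open>This is Gram-Schmidt in the energy product: by conjugacy of the earlier directions only
  the term \<open>m = j\<close> of the sum survives, and it cancels the contribution of
  \<open>B (res i)\<close>.\<close>

lemma dir_conj: "j < i \<Longrightarrow> L (dir i) \<bullet> dir j = 0"
proof (induction i arbitrary: j rule: less_induct)
  case (less i)
  \<comment> \<open>Both indices lie below \<open>i\<close>; the induction hypothesis is applied at
    the larger one.\<close>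
  have orth: "L (dir m) \<bullet> dir j = 0" if "m < i" "m \<noteq> j" for m
    using that less.IH[of m j] less.IH[of j m] less.prems sym[of "dir m" "dir j"] dir_mem
    by (cases "j < m") auto
  define z where "z = B (res i)"
  define b where "b m = - (L z \<bullet> dir m) / (L (dir m) \<bullet> dir m)" for m
  have "L (dir i) \<bullet> dir j = L z \<bullet> dir j + (\<Sum>m<i. b m * (L (dir m) \<bullet> dir j))"
    using lin by (subst dir_eq)
      (simp add: z_def b_def linear_add linear_sum linear_scale linear_neg inner_add_left inner_sum_left)
  also have "(\<Sum>m<i. b m * (L (dir m) \<bullet> dir j)) = (\<Sum>m<i. if m = j then - (L z \<bullet> dir j) else 0)"
    using divide_dir[of "L z" j] by (intro sum.cong) (auto simp: b_def orth)
  also have "\<dots> = - (L z \<bullet> dir j)"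
    using less.prems by simp
  finally show ?case by simp
qed

text \<open>The step length removes the component of the error along the newest direction, and
  conjugacy preserves the orthogonality to the older ones.\<close>

lemma err_orth_dir: "j < i \<Longrightarrow> L (err i) \<bullet> dir j = 0"
proof (induction i)
  case (Suc i)
  have "L (err (Suc i)) \<bullet> dir j
      = L (err i) \<bullet> dir j - (res i \<bullet> dir i) / (L (dir i) \<bullet> dir i) * (L (dir i) \<bullet> dir j)"
    unfolding err_Suc linear_diff[OF lin] linear_scale[OF lin] by (simp only: inner_diff_left inner_scaleR_left)
  also have "\<dots> = 0"
  proof (cases "j = i")
    case True
    then show ?thesis
      using divide_dir[of "res i" i] by (simp only: res_eq[symmetric])
  next
    case False
    with Suc show ?thesis
      using dir_conj[of j i] by simp
  qed
  finally show ?case .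
qed simp

text \<open>The plain preconditioned update \<open>err i - B (res i)\<close> differs from the new
  error by a combination of directions up to \<open>i\<close>. The new error is orthogonal to all of
  them, so Pythagoras applies.\<close>

lemma pcg_step_minimal:
  "L (err (Suc i)) \<bullet> err (Suc i) \<le> L (err i - B (res i)) \<bullet> (err i - B (res i))"
proof -
  let ?e = "err (Suc i)"
  define q where "q = ((res i \<bullet> dir i) / (L (dir i) \<bullet> dir i)) *\<^sub>R dir i - B (res i)"
  define s where "s = (\<Sum>j<i. (- (L (B (res i)) \<bullet> dir j) / (L (dir j) \<bullet> dir j)) *\<^sub>R dir j)"
  have qW: "q \<in> W"
    unfolding q_def by (intro subspace_diff[OF sub] subspace_scale[OF sub] B dir_mem res_mem)
  have eW: "?e \<in> W" by (rule err_mem)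
  have eo: "L ?e \<bullet> dir j = 0" if "j < Suc i" for j
    using that by (rule err_orth_dir)
  have "L ?e \<bullet> s = 0"
    unfolding s_def inner_sum_right using eo by (intro sum.neutral) simp
  moreover have "dir i = B (res i) + s"
    unfolding s_def by (rule dir_eq)
  ultimately have "L ?e \<bullet> B (res i) = 0"
    using eo[OF lessI] by (simp only: inner_add_right add_0_right)
  then have "L ?e \<bullet> q = 0"
    unfolding q_def inner_diff_right inner_scaleR_right using eo[OF lessI] by simp
  from energy_add_orth[OF eW qW this]
  have "L ?e \<bullet> ?e \<le> L (?e + q) \<bullet> (?e + q)"
    using nonneg[OF qW] by (simp only: le_add_same_cancel1)
  also have "?e + q = err i - B (res i)"
    unfolding err_Suc q_def by simp
  finally show ?thesis .
qed

end

lemma npcg_mem: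
  assumes "\<And>f. f \<in> W \<Longrightarrow> B f \<in> W" "f \<in> W"
  shows "npcg n L B f \<in> W"
proof -
  obtain v where v: "v \<in> W" "f = L v"
    using image_eq assms(2) by blast
  have "v - (v - npcg n L B f) \<in> W"
    unfolding npcg_def v(2) by (intro subspace_diff[OF sub] v err_mem assms(1))
  then show ?thesis by simp
qed

text \<open>Nonlinearity of \<open>B\<close> is harmless: the residual is \<open>L\<close> of the
  current error, so \<open>contr\<close> is applied afresh at each error and every step gains a
  factor \<open>d\<close>.\<close>

lemma npcg_error:
  assumes B: "\<And>f. f \<in> W \<Longrightarrow> B f \<in> W" and v: "v \<in> W" and d: "0 \<le> d"
    and contr: "\<And>u. u \<in> W \<Longrightarrow> L (u - B (L u)) \<bullet> (u - B (L u)) \<le> d * (L u \<bullet> u)"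
  shows "L (v - npcg n L B (L v)) \<bullet> (v - npcg n L B (L v)) \<le> d ^ n * (L v \<bullet> v)"
proof (induction n)
  case 0
  show ?case by (simp add: npcg_def)
next
  case (Suc n)
  let ?e = "\<lambda>i. v - pcg_iter L B (L v) i"
  note e = err_mem[where B = B, OF v B, of n] and r = res_eq[where B = B, OF v B, of n]
  have "L (?e (Suc n)) \<bullet> ?e (Suc n) \<le> L (?e n - B (L (?e n))) \<bullet> (?e n - B (L (?e n)))"
    using pcg_step_minimal[where B = B, OF v B, of n] by (simp only: r)
  also have "\<dots> \<le> d * (L (?e n) \<bullet> ?e n)"
    by (rule contr[OF e])
  also have "\<dots> \<le> d * (d ^ n * (L v \<bullet> v))"
    using Suc d unfolding npcg_def by (rule mult_left_mono)
  finally show ?case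
    unfolding npcg_def by (simp only: power_Suc mult.assoc)
qed

end

section \<open>One level of the cycle\<close>

lemma spd_on_level_op:
  fixes W :: "'a::euclidean_space set"
  assumes "subspace W" "spd A"
  shows "spd_on W (level_op A W)"
proof (rule spd_on.intro)
  show "linear (level_op A W)"
    using assms by (simp add: linear_level_op spd_def)
  show "level_op A W u \<bullet> v = level_op A W v \<bullet> u" if "u \<in> W" "v \<in> W" for u v
    using that assms by (metis inner_commute level_op_inner spd_def)
qed (use assms in \<open>auto simp: level_op spd_def\<close>)

section \<open>Orthogonal projections\<close>

text \<open>Definiteness forces uniqueness. Taking the identity for \<open>A\<close> covers the
  Euclidean projection as well.\<close>

lemma orth_proj_eqI:
  assumes "subspace W" "spd A" "w \<in> W" "\<And>v. v \<in> W \<Longrightarrow> A (u - w) \<bullet> v = 0"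
  shows "orth_proj (\<lambda>x y. A x \<bullet> y) W u = w"
  unfolding orth_proj_def
proof (rule the_equality)
  fix w' assume w': "w' \<in> W \<and> (\<forall>v\<in>W. A (u - w') \<bullet> v = 0)"
  then have "w - w' \<in> W"
    using assms by (simp add: subspace_diff)
  moreover have "A (w - w') = A (u - w') - A (u - w)"
    using assms(2) by (simp add: spd_def flip: linear_diff)
  ultimately have "A (w - w') \<bullet> (w - w') = 0"
    using assms(4) w' by (simp add: inner_diff_left)
  then show "w' = w"
    using assms(2) unfolding spd_def by (metis eq_iff_diff_eq_0 less_irrefl)
qed (use assms in auto)

text \<open>Existence comes from surjectivity of the level operator: the projection solves the level
  problem whose right-hand side is \<open>level_op A W u\<close>.\<close>

lemma orth_proj:
  fixes W :: "'a::euclidean_space set"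
  assumes "subspace W" "spd A"
  shows orth_proj_mem: "orth_proj (\<lambda>x y. A x \<bullet> y) W u \<in> W"
    and orth_proj_orth: "v \<in> W \<Longrightarrow> A (u - orth_proj (\<lambda>x y. A x \<bullet> y) W u) \<bullet> v = 0"
proof -
  interpret spd_on W "level_op A W"
    by (rule spd_on_level_op[OF assms])
  obtain w where w: "w \<in> W" "level_op A W u = level_op A W w"
    using image_eq level_op_mem[OF assms(1)] by (metis imageE)
  have o: "A (u - w) \<bullet> v = 0" if "v \<in> W" for v
    using that w assms level_op_inner[OF assms(1) that, of A u] level_op_inner[OF assms(1) that, of A w]
    by (simp add: spd_def linear_diff inner_diff_left)
  have "orth_proj (\<lambda>x y. A x \<bullet> y) W u = w"
    using orth_proj_eqI[OF assms w(1) o] by simp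
  with w o show "orth_proj (\<lambda>x y. A x \<bullet> y) W u \<in> W"
      "v \<in> W \<Longrightarrow> A (u - orth_proj (\<lambda>x y. A x \<bullet> y) W u) \<bullet> v = 0"
    by auto
qed

text \<open>Both sides pair with \<open>v\<close> in \<open>U\<close> to
  \<open>A w \<bullet> v\<close>. Thus the restricted residual is the right-hand side of a coarse
  problem whose exact solution is the energy projection of \<open>w\<close>.\<close>

lemma orth_proj_level_op:
  fixes U W :: "'a::euclidean_space set"
  assumes "subspace U" "subspace W" "U \<subseteq> W" "spd A"
  shows "orth_proj (\<bullet>) U (level_op A W w) = level_op A U (orth_proj (\<lambda>x y. A x \<bullet> y) U w)"
proof -
  have "spd (\<lambda>x::'a. x)"
    by (simp add: spd_def linear_id[unfolded id_def])
  moreover have "(level_op A W w - level_op A U (orth_proj (\<lambda>x y. A x \<bullet> y) U w)) \<bullet> v = 0"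
    if "v \<in> U" for v
    using that assms orth_proj_orth[OF assms(1,4) that, of w] level_op_inner[OF assms(2), of v A w]
      level_op_inner[OF assms(1) that]
    by (auto simp: inner_diff_left spd_def linear_diff)
  ultimately show ?thesis
    using orth_proj_eqI[of U "\<lambda>x. x"] assms level_op_mem by blast
qed

section \<open>Smoothing and the two-level error\<close>

text \<open>Here \<open>s\<close> is \<open>S' v\<close>, and the symmetrized smoother maps
  \<open>L v\<close> to \<open>v - S s\<close>. Moving \<open>S\<close> across the energy product
  yields the square of \<open>s\<close>.\<close>

lemma symm_smoother_energy:
  fixes W :: "'a::euclidean_space set"
  assumes "spd_on W L" "linear_endo_on W R" "v \<in> W"
  defines "s \<equiv> v - adjoint_on W R (L v)"
  shows "symm_smoother W L R (L v) \<bullet> L v = L v \<bullet> v - L s \<bullet> s"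
proof -
  interpret spd_on W L by fact
  have s: "s \<in> W"
    unfolding s_def using assms(3) by (intro subspace_diff[OF sub] adjoint_on_mem[OF sub assms(2)])
  have "L s \<bullet> s = L s \<bullet> v - adjoint_on W R (L v) \<bullet> L s"
    by (metis s_def inner_commute inner_diff_right)
  also have "adjoint_on W R (L v) \<bullet> L s = L v \<bullet> R (L s)"
    by (rule adjoint_on_inner[OF sub assms(2) maps[OF s]])
  also have "L s \<bullet> v = L v \<bullet> s"
    by (rule sym[OF s assms(3)])
  finally show ?thesis
    unfolding symm_smoother_def inv_into_f_f[OF inj assms(3)] Let_def s_def[symmetric]
    by (simp add: inner_diff_left inner_diff_right inner_commute)
qed

lemma smoothing_projection_bound:
  fixes U W :: "'a::euclidean_space set"
  assumes U: "subspace U" and W: "subspace W" and UW: "U \<subseteq> W" and A: "spd A"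
    and R: "linear_endo_on W R" and c: "0 < c\<^sub>1" "0 < c\<^sub>2"
    and approx: "\<And>v. v \<in> W \<Longrightarrow>
      (energy_norm (level_op A W) (v - orth_proj (\<lambda>x y. A x \<bullet> y) U v))\<^sup>2
        \<le> c\<^sub>1 / \<rho> * (norm (level_op A W v))\<^sup>2"
    and smooth: "\<And>v. v \<in> W \<Longrightarrow> c\<^sub>2 / \<rho> * (v \<bullet> v) \<le> symm_smoother W (level_op A W) R v \<bullet> v"
    and v: "v \<in> W"
  defines "w \<equiv> v - R (level_op A W v)"
  defines "x \<equiv> orth_proj (\<lambda>x y. A x \<bullet> y) U w"
  shows "A x \<bullet> x + (1 + c\<^sub>2 / c\<^sub>1) * (A (w - x) \<bullet> (w - x)) \<le> A v \<bullet> v"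
proof -
  let ?L = "level_op A W"
  interpret spd_on W ?L
    by (rule spd_on_level_op[OF W A])
  define c where "c = c\<^sub>2 / c\<^sub>1"
  define q where "q = w - x"
  \<comment> \<open>This is the test vector of the duality argument. As \<open>q\<close> is
    orthogonal to \<open>U\<close>, its projection is again \<open>x\<close>, and
    \<open>z - x\<close> is \<open>(1 + c) *\<^sub>R q\<close>.\<close>
  define z where "z = x + (1 + c) *\<^sub>R q"
  define s where "s = z - adjoint_on W R (?L z)"
  have RW: "R (?L v) \<in> W"
    using R maps[OF v] by (auto simp: linear_endo_on_def)
  have w: "w \<in> W"
    unfolding w_def using v RW by (rule subspace_diff[OF sub])
  have xU: "x \<in> U"
    unfolding x_def by (rule orth_proj_mem[OF U A])
  then have x: "x \<in> W"
    using UW by blast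
  have q: "q \<in> W"
    unfolding q_def using w x by (rule subspace_diff[OF sub])
  have z: "z \<in> W"
    unfolding z_def using x q by (intro subspace_add[OF sub] subspace_scale[OF sub])
  have s: "s \<in> W"
    unfolding s_def using z by (intro subspace_diff[OF sub] adjoint_on_mem[OF sub R])
  have qo: "A q \<bullet> u = 0" if "u \<in> U" for u
    unfolding q_def x_def by (rule orth_proj_orth[OF U A that])
  have Pz: "orth_proj (\<lambda>x y. A x \<bullet> y) U z = x"
    using qo A xU by (intro orth_proj_eqI[OF U A]) (auto simp: z_def spd_def linear_scale)
  have "?L x \<bullet> q = 0"
    using qo[OF xU] sym[OF x q] level_op_inner[OF W x] by simp
  \<comment> \<open>This is the energy adjointness of \<open>S\<close> and \<open>S'\<close>, with
    \<open>s = S' z\<close> and \<open>w = S v = x + q\<close>.\<close>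
  moreover have "?L z \<bullet> (x + q) = ?L s \<bullet> v"
  proof -
    have "?L s \<bullet> v = s \<bullet> ?L v"
      using sym[OF s v] by (simp add: inner_commute)
    also have "\<dots> = z \<bullet> ?L v - ?L z \<bullet> R (?L v)"
      unfolding s_def using adjoint_on_inner[OF W R maps[OF v]] by (simp add: inner_diff_left)
    also have "\<dots> = ?L z \<bullet> w"
      unfolding w_def using sym[OF v z] by (simp add: inner_diff_right inner_commute)
    finally show ?thesis
      by (simp add: q_def)
  qed
  moreover have "?L s \<bullet> s + c * (?L ((1 + c) *\<^sub>R q) \<bullet> ((1 + c) *\<^sub>R q)) \<le> ?L z \<bullet> z"
  proof -
    have zx: "z - x = (1 + c) *\<^sub>R q"
      by (simp add: z_def)
    \<comment> \<open>The factor \<open>c\<close> turns the approximation constant into the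
      smoothing constant, so the smoothing property at \<open>?L z\<close> takes over.\<close>
    have "c * (?L ((1 + c) *\<^sub>R q) \<bullet> ((1 + c) *\<^sub>R q)) \<le> c * (c\<^sub>1 / \<rho> * (?L z \<bullet> ?L z))"
      using approx[OF z] c q energy_norm_sq[OF subspace_scale[OF sub q]]
      by (intro mult_left_mono) (simp_all add: Pz zx c_def power2_norm_eq_inner)
    also have "\<dots> = c\<^sub>2 / \<rho> * (?L z \<bullet> ?L z)"
      using c by (simp add: c_def)
    also have "\<dots> \<le> ?L z \<bullet> z - ?L s \<bullet> s"
      using smooth[OF maps[OF z]] symm_smoother_energy[OF spd_on_axioms R z] by (simp add: s_def)
    finally show ?thesis by simp
  qed
  ultimately have "?L x \<bullet> x + (1 + c) * (?L q \<bullet> q) \<le> ?L v \<bullet> v"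
    using c by (intro smoother_duality[OF v x q s]) (auto simp: z_def c_def)
  then show ?thesis
    using v x q level_op_inner[OF W] by (simp add: c_def q_def)
qed

text \<open>The error splits orthogonally into \<open>w - x\<close> and a coarse error in
  \<open>U\<close>. The coarse solver \<open>C\<close> may be nonlinear, as it enters only through
  its error at the single vector \<open>x\<close>.\<close>

lemma two_level_error:
  fixes U W :: "'a::euclidean_space set"
  assumes U: "subspace U" and W: "subspace W" and UW: "U \<subseteq> W" and A: "spd A"
    and R: "linear_endo_on W R" and c: "0 < c\<^sub>1" "0 < c\<^sub>2"
    and approx: "\<And>v. v \<in> W \<Longrightarrow>
      (energy_norm (level_op A W) (v - orth_proj (\<lambda>x y. A x \<bullet> y) U v))\<^sup>2
        \<le> c\<^sub>1 / \<rho> * (norm (level_op A W v))\<^sup>2"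
    and smooth: "\<And>v. v \<in> W \<Longrightarrow> c\<^sub>2 / \<rho> * (v \<bullet> v) \<le> symm_smoother W (level_op A W) R v \<bullet> v"
    and C: "\<And>f. f \<in> U \<Longrightarrow> C f \<in> U"
    and coarse: "\<And>u. u \<in> U \<Longrightarrow>
      A (u - C (level_op A U u)) \<bullet> (u - C (level_op A U u)) \<le> c\<^sub>1 / (c\<^sub>1 + c\<^sub>2) * (A u \<bullet> u)"
    and v: "v \<in> W"
  defines "w \<equiv> v - R (level_op A W v)"
  defines "e \<equiv> w - C (orth_proj (\<bullet>) U (level_op A W w))"
  shows "A e \<bullet> e \<le> c\<^sub>1 / (c\<^sub>1 + c\<^sub>2) * (A v \<bullet> v)"
proof -
  define x where "x = orth_proj (\<lambda>x y. A x \<bullet> y) U w"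
  define y where "y = x - C (level_op A U x)"
  let ?d = "c\<^sub>1 / (c\<^sub>1 + c\<^sub>2)"
  have xU: "x \<in> U"
    unfolding x_def by (rule orth_proj_mem[OF U A])
  have yU: "y \<in> U"
    unfolding y_def using xU by (intro subspace_diff[OF U] C level_op_mem[OF U])
  have "A (w - x) \<bullet> y = 0"
    unfolding x_def by (rule orth_proj_orth[OF U A yU])
  moreover have "A y \<bullet> (w - x) = A (w - x) \<bullet> y"
    using A by (metis inner_commute spd_def)
  moreover have "e = (w - x) + y"
    unfolding e_def y_def x_def orth_proj_level_op[OF U W UW A] by simp
  ultimately have "A e \<bullet> e = A (w - x) \<bullet> (w - x) + A y \<bullet> y"
    using A by (simp add: spd_def linear_add inner_add_left inner_add_right)
  also have "\<dots> \<le> A (w - x) \<bullet> (w - x) + ?d * (A x \<bullet> x)"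
    using coarse[OF xU] unfolding y_def by simp
  \<comment> \<open>The value of \<open>?d\<close> is the one for which
    \<open>?d * (1 + c\<^sub>2 / c\<^sub>1) = 1\<close>.\<close>
  also have "\<dots> = ?d * (A x \<bullet> x + (1 + c\<^sub>2 / c\<^sub>1) * (A (w - x) \<bullet> (w - x)))"
  proof -
    have "1 + c\<^sub>2 / c\<^sub>1 = (c\<^sub>1 + c\<^sub>2) / c\<^sub>1"
      using c by (simp add: add_divide_distrib)
    then have "?d * (1 + c\<^sub>2 / c\<^sub>1) = 1"
      using c by simp
    then show ?thesis
      by (simp only: distrib_left mult.assoc[symmetric] mult_1 add.commute)
  qed
  also have "\<dots> \<le> ?d * (A v \<bullet> v)"
    unfolding x_def w_def using c
    by (intro mult_left_mono smoothing_projection_bound[OF U W UW A R c approx smooth v]) auto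
  finally show ?thesis .
qed

section \<open>Induction over the levels\<close>

theorem theorem3p12:
  fixes A :: "'a::euclidean_space \<Rightarrow> 'a"
    and V :: "nat \<Rightarrow> 'a set"
    and R :: "nat \<Rightarrow> 'a \<Rightarrow> 'a"
    and J n :: nat
    and c\<^sub>1 c\<^sub>2 \<delta> :: real
  assumes J: "1 \<le> J"
    and A: "spd A"
    and V: "\<And>k. k \<in> {1..J} \<Longrightarrow> subspace (V k)"
    and nested: "\<And>k. k \<in> {1..<J} \<Longrightarrow> V k \<subseteq> V (Suc k)"
    and top: "V J = UNIV"
    and R: "\<And>k. k \<in> {2..J} \<Longrightarrow> linear_endo_on (V k) (R k)"
    and convergent: "\<And>k. k \<in> {2..J} \<Longrightarrow>
      energy_onorm (V k) (level_op A (V k)) (\<lambda>v. v - R k (level_op A (V k) v)) < 1"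
    and n: "1 \<le> n"
    and c: "0 < c\<^sub>1" "0 < c\<^sub>2"
    and approximation: "\<And>k v. k \<in> {2..J} \<Longrightarrow> v \<in> V k \<Longrightarrow>
      (energy_norm (level_op A (V k)) (v - orth_proj (\<lambda>x y. A x \<bullet> y) (V (k - 1)) v))\<^sup>2
        \<le> c\<^sub>1 / spectral_radius_on (V k) (level_op A (V k)) * (norm (level_op A (V k) v))\<^sup>2"
    and smoothing: "\<And>k v. k \<in> {2..J} \<Longrightarrow> v \<in> V k \<Longrightarrow>
      c\<^sub>2 / spectral_radius_on (V k) (level_op A (V k)) * (v \<bullet> v)
        \<le> symm_smoother (V k) (level_op A (V k)) (R k) v \<bullet> v"
    and \<delta>: "\<delta> = c\<^sub>1 / (c\<^sub>1 + c\<^sub>2)"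
  shows "\<delta> < 1 \<and>
    (\<forall>k\<in>{1..J}. \<forall>v\<in>V k.
       (energy_norm (level_op A (V k)) (v - amli_ns n A V R k (level_op A (V k) v)))\<^sup>2
         \<le> \<delta> * (energy_norm (level_op A (V k)) v)\<^sup>2 \<and>
       (energy_norm (level_op A (V k)) (v - amli_ns_pcg n A V R k (level_op A (V k) v)))\<^sup>2
         \<le> \<delta> ^ n * (energy_norm (level_op A (V k)) v)\<^sup>2)"
proof -
  let ?L = "\<lambda>k. level_op A (V k)" and ?B = "amli_ns n A V R"
  have spd: "spd_on (V k) (?L k)" if "k \<in> {1..J}" for k
    using spd_on_level_op[OF V[OF that] A] .
  have d: "0 \<le> \<delta>" "\<delta> < 1"
    using c by (auto simp: \<delta>)
  \<comment> \<open>Since at least one PCG step is made, the coarse solver is no worse than its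
    preconditioner and the same \<delta> serves on all levels.\<close>
  have pow: "\<delta> ^ n \<le> \<delta>"
    using d n power_decreasing[of 1 n \<delta>] by simp
  \<comment> \<open>Energies are written with \<open>A\<close> itself, which agrees with each level
    operator on its level and lets different levels be compared.\<close>
  have main: "(\<forall>f\<in>V k. ?B k f \<in> V k) \<and>
      (\<forall>v\<in>V k. A (v - ?B k (?L k v)) \<bullet> (v - ?B k (?L k v)) \<le> \<delta> * (A v \<bullet> v))"
    if "1 \<le> k" "k \<le> J" for k
    using that
  proof (induction k rule: dec_induct)
    \<comment> \<open>The solve on level 1 is exact, so the error is 0.\<close>
    case base
    interpret spd_on "V 1" "?L 1"
      using spd J by simp
    show ?case
      using inv_into_mem d A nonneg level_op_inner[OF sub]
      by (auto simp: inv_into_f_f[OF inj, simplified] spd_def linear_0)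
  next
    case (step m)
    then have m: "m \<in> {1..J}" "Suc m \<in> {1..J}" "Suc m \<in> {2..J}" "m \<in> {1..<J}"
      by auto
    define C where "C = npcg n (?L m) (?B m)"
    interpret U: spd_on "V m" "?L m" by (rule spd[OF m(1)])
    interpret W: spd_on "V (Suc m)" "?L (Suc m)" by (rule spd[OF m(2)])
    \<comment> \<open>As \<open>m\<close> is at least 1, the dummy level 0 never occurs as the
      coarse level.\<close>
    have B_eq: "?B (Suc m) f = R (Suc m) f +
        C (orth_proj (\<bullet>) (V m) (f - ?L (Suc m) (R (Suc m) f)))" for f
      using m(1) by (cases m) (auto simp: C_def Let_def)
    have Bm: "?B m f \<in> V m" if "f \<in> V m" for f
      using step that by auto
    have C: "C f \<in> V m" if "f \<in> V m" for f
      unfolding C_def using Bm that by (rule U.npcg_mem)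
    have coarse: "A (u - C (?L m u)) \<bullet> (u - C (?L m u)) \<le> c\<^sub>1 / (c\<^sub>1 + c\<^sub>2) * (A u \<bullet> u)"
      if u: "u \<in> V m" for u
    proof -
      have eU: "u - C (?L m u) \<in> V m"
        using u by (intro subspace_diff[OF U.sub] C U.maps)
      have "?L m (u - ?B m (?L m u)) \<bullet> (u - ?B m (?L m u)) \<le> \<delta> * (?L m u \<bullet> u)"
        if "u \<in> V m" for u
        using step that level_op_inner[OF U.sub] subspace_diff[OF U.sub that Bm[OF U.maps[OF that]]]
        by auto
      then have "?L m (u - C (?L m u)) \<bullet> (u - C (?L m u)) \<le> \<delta> ^ n * (?L m u \<bullet> u)"
        unfolding C_def using U.npcg_error[where B = "?B m", OF Bm u d(1)] by blast
      also have "\<dots> \<le> \<delta> * (?L m u \<bullet> u)"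
        using pow U.nonneg[OF u] by (rule mult_right_mono)
      finally show ?thesis
        using level_op_inner[OF U.sub] eU u by (simp add: \<delta>)
    qed
    have sub: "V m \<subseteq> V (Suc m)"
      by (rule nested[OF m(4)])
    show ?case
    proof (intro conjI ballI)
      fix f assume "f \<in> V (Suc m)"
      then have "R (Suc m) f \<in> V (Suc m)"
        using R[OF m(3)] by (auto simp: linear_endo_on_def)
      moreover have "orth_proj (\<bullet>) (V m) g \<in> V m" for g
        using orth_proj_mem[of "V m" "\<lambda>x. x"] U.sub
        by (simp add: spd_def linear_id[unfolded id_def])
      ultimately show "?B (Suc m) f \<in> V (Suc m)"
        unfolding B_eq using sub by (intro subspace_add[OF W.sub]) (auto intro: C)
    next
      fix v assume v: "v \<in> V (Suc m)"
      \<comment> \<open>The vector \<open>w\<close> is the error after smoothing; by linearity the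
        residual passed to the coarse level is the level operator at \<open>w\<close>.\<close>
      define w where "w = v - R (Suc m) (?L (Suc m) v)"
      have "v - ?B (Suc m) (?L (Suc m) v) = w - C (orth_proj (\<bullet>) (V m) (?L (Suc m) w))"
        unfolding B_eq w_def linear_diff[OF W.lin] by simp
      then show "A (v - ?B (Suc m) (?L (Suc m) v)) \<bullet> (v - ?B (Suc m) (?L (Suc m) v))
          \<le> \<delta> * (A v \<bullet> v)"
        using two_level_error[where C = C, OF U.sub W.sub sub A R[OF m(3)] c approximation[OF m(3), unfolded diff_Suc_1]
            smoothing[OF m(3)] C coarse v]
        by (simp only: w_def \<delta>)
    qed
  qed
  have "(energy_norm (?L k) (v - ?B k (?L k v)))\<^sup>2 \<le> \<delta> * (energy_norm (?L k) v)\<^sup>2 \<and>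
      (energy_norm (?L k) (v - amli_ns_pcg n A V R k (?L k v)))\<^sup>2 \<le> \<delta> ^ n * (energy_norm (?L k) v)\<^sup>2"
    if k: "k \<in> {1..J}" and v: "v \<in> V k" for k v
  proof -
    interpret spd_on "V k" "?L k" by (rule spd[OF k])
    have Bk: "?B k f \<in> V k" if "f \<in> V k" for f
      using main[of k] k that by auto
    have e: "u - ?B k (?L k u) \<in> V k" if "u \<in> V k" for u
      using that by (intro subspace_diff[OF sub] Bk maps)
    have e': "v - npcg n (?L k) (?B k) (?L k v) \<in> V k"
      using v by (intro subspace_diff[OF sub] npcg_mem Bk maps)
    have contr: "?L k (u - ?B k (?L k u)) \<bullet> (u - ?B k (?L k u)) \<le> \<delta> * (?L k u \<bullet> u)"
      if "u \<in> V k" for u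
      using main[of k] k that level_op_inner[OF sub] e by auto
    show ?thesis
      unfolding amli_ns_pcg_def energy_norm_sq[OF v] energy_norm_sq[OF e[OF v]] energy_norm_sq[OF e']
      using contr[OF v] npcg_error[where B = "?B k", OF Bk v d(1) contr] by blast
  qed
  then show ?thesis
    using d(2) by blast
qed

end
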